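(* Let $\gamma\in(0,1)$, $\epsilon>0$, $x\in\mathcal X$. Then $$\min_{\pi\in\hat\Pi^{\gamma}_{x,\epsilon}}J_{\mathrm{MCMP}}(x;\pi)=\min_{\pi\in\hat\Pi^{\gamma}_{x,\epsilon}}J^{(M)}_{obj}((x,s);\pi)=J^{(M)}_{obj}\bigl((x,s);\pi^*_{c^*_{\gamma,\epsilon}(x),\gamma,\epsilon}\bigr)=c^*_{\gamma,\epsilon}(x).$$
   Context: $\mathcal M$ is a discrete-time Markov decision process with finite state set $\mathcal X=\{0,1,\dots,N_X\}$, finite action set $\mathcal C=\{1,\dots,N_C\}$ and countable disturbance set $\mathcal W$. When action $u_t$ is taken in state $x_t$, disturbance $w_t\in\mathcal W$ occurs with probability $p(w_t|x_t,u_t)$, the next state is $x_{t+1}=f(x_t,u_t,w_t)$, and a one-stage cost $g(x_t,u_t,w_t)\ge 0$ is incurred; for each fixed $(x,u)$ the mean and variance of $g(x,u,w)$ under $p(\cdot|x,u)$ are finite. State $0$ is terminal: $f(0,u,w)=0$ and $g(0,u,w)=0$ for all $u,w$. The total cost up to time $t$ is $r_t=\sum_{k<t}g(x_k,u_k,w_k)$ (for $t=\infty$, the infinite sum). A policy $\pi=(\mu_0,\mu_1,\dots)$ selects action $u_t$ with probability $\mu_t(u_t|H_t)$, where $H_t=(x_0,r_0,u_0,\dots,x_t,r_t)$; $\Pi$ is the set of all policies. $E^{\mathcal M,\pi}$ denotes expectation when $\pi$ is applied to $\mathcal M$. Let $h_d(0)=0$, $h_d(x')=1$ for $x'\neq0$,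 and $$L_d^{\gamma}(x;\pi)=E^{\mathcal M,\pi}\Bigl\{\sum_{t=0}^{\infty}\gamma^t(1-\gamma)h_d(x_t)\Bigm|x_0=x\Bigr\},\qquad \hat\Pi^{\gamma}_{x,\epsilon}=\{\pi\in\Pi\mid L_d^{\gamma}(x;\pi)\le\epsilon\}.$$ Define $J_{\mathrm{MCMP}}(x;\pi)=E^{\mathcal M,\pi}\{r_\tau\mid x_0=x\}$, where $$\tau=\min\{t=0,1,\dots\mid\Pr(\exists t'\ge t,\ x_{t'}=0\mid H_t,\pi)=0\}$$ and $\tau=\infty$ if there is no such $t$. For $\pi\in\Pi$, $J^{(M)}_{obj}((x,s);\pi)$ is the expected total cost of $\pi$, started with label $s$ ("not failed"), in an augmented MDP whose states carry a label in $\{s,f\}$ and in which no cost $g$ is charged after the task is labelled failed; it is evaluated by the identity $J^{(M)}_{obj}((x,s);\pi)=J_{\mathrm{MCMP}}(x;\pi)$. Let $\mathcal A$ be the set of pairs $\alpha=(\alpha_o,\alpha_d)$ with $\alpha_o,\alpha_d\ge0$, $\alpha_o+\alpha_d=1$ (probability distributions on the two MDPs corresponding to objective and constraint). For $c\ge0$ put $$J_{c,\gamma,\epsilon}((x,s),\alpha,\pi)=\alpha_o\,J^{(M)}_{obj}((x,s);\pi)+\frac{c}{\epsilon}\,\alpha_d\,L_d^{\gamma}(x;\pi)$$ (with $0\cdot\infty=0$), let $\pi^*_{c,\gamma,\epsilon}$ denote a policy in $\arg\min_{\pi\in\Pi}\{\max_{\alpha\in\mathcal A}J_{c,\gamma,\epsilon}((x,s),\alpha,\pi)\}$,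 and let $$c^*_{\gamma,\epsilon}(x)=\min\Bigl\{c\in[0,\infty)\Bigm|\min_{\pi\in\Pi}\max_{\alpha\in\mathcal A}J_{c,\gamma,\epsilon}((x,s),\alpha,\pi)\le c\Bigr\}.$$
   Formalization: As stated it fails if some policy in Π has J_MCMP=0 but the constrained minimum is positive (c=0 then gives c*=0). The equalities with c* are proved outside that case, and always with c* as infimum over c>0; the π* equality is for finite c*. *)

theory Defs
  imports "HOL-Probability.Probability" "HOL-Library.Extended_Nat"
begin

text \<open>States are \<open>{0..NX}\<close>, actions \<open>{1..NC}\<close>; the countable disturbance set is the
  type \<open>'w\<close>. The values of the functions outside
  these ranges play no role.\<close>

record 'w mdp =
  NX :: nat
  NC :: nat
  nxt :: "nat \<Rightarrow> nat \<Rightarrow> 'w \<Rightarrow> nat"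
  cost :: "nat \<Rightarrow> nat \<Rightarrow> 'w \<Rightarrow> real"
  noise :: "nat \<Rightarrow> nat \<Rightarrow> 'w pmf"

definition wf_mdp :: "'w::countable mdp \<Rightarrow> bool" where
  "wf_mdp M \<longleftrightarrow> 1 \<le> NC M \<and>
     (\<forall>x\<in>{0..NX M}. \<forall>u\<in>{1..NC M}.
        (\<forall>w. nxt M x u w \<in> {0..NX M} \<and> 0 \<le> cost M x u w) \<and>
        integrable (measure_pmf (noise M x u)) (cost M x u) \<and>
        integrable (measure_pmf (noise M x u))
          (\<lambda>w. (cost M x u w - measure_pmf.expectation (noise M x u) (cost M x u))\<^sup>2)) \<and>
     (\<forall>u\<in>{1..NC M}. \<forall>w. nxt M 0 u w = 0 \<and> cost M 0 u w = 0)"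

text \<open>A sample point \<open>\<omega>\<close> lists the pairs \<open>(u\<^sub>t, w\<^sub>t)\<close>; together with the initial state it
  determines the states and the costs.\<close>

primrec st :: "'w mdp \<Rightarrow> nat \<Rightarrow> (nat \<Rightarrow> nat \<times> 'w) \<Rightarrow> nat \<Rightarrow> nat" where
  "st M x \<omega> 0 = x"
| "st M x \<omega> (Suc t) = nxt M (st M x \<omega> t) (fst (\<omega> t)) (snd (\<omega> t))"

definition stage_cost :: "'w mdp \<Rightarrow> nat \<Rightarrow> (nat \<Rightarrow> nat \<times> 'w) \<Rightarrow> nat \<Rightarrow> real" where
  "stage_cost M x \<omega> t = cost M (st M x \<omega> t) (fst (\<omega> t)) (snd (\<omega> t))"

text \<open>\<open>(x\<^sub>0,r\<^sub>0,u\<^sub>0,\<dots>,x\<^sub>t,r\<^sub>t)\<close>: a list of \<open>t\<close> triples followed by the last pair.\<close>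

type_synonym history = "(nat \<times> real \<times> nat) list \<times> nat \<times> real"

definition hist :: "'w mdp \<Rightarrow> nat \<Rightarrow> (nat \<Rightarrow> nat \<times> 'w) \<Rightarrow> nat \<Rightarrow> history" where
  "hist M x \<omega> t =
     (map (\<lambda>k. (st M x \<omega> k, \<Sum>j<k. stage_cost M x \<omega> j, fst (\<omega> k))) [0..<t],
      st M x \<omega> t, \<Sum>j<t. stage_cost M x \<omega> j)"

type_synonym policy = "nat \<Rightarrow> history \<Rightarrow> nat pmf"

definition policies :: "'w mdp \<Rightarrow> policy set" where
  "policies M = {\<pi>. \<forall>t h. set_pmf (\<pi> t h) \<subseteq> {1..NC M}}"

text \<open>The law of \<open>\<omega>\<close>, from the one-step kernels by the Ionescu-Tulcea theorem.\<close>

definition step_kernel :: "'w mdp \<Rightarrow> nat \<Rightarrow> policy \<Rightarrow> nat \<Rightarrow> (nat \<Rightarrow> nat \<times> 'w) \<Rightarrow> (nat \<times> 'w) measure" where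
  "step_kernel M x \<pi> t \<omega> = measure_pmf
     (bind_pmf (\<pi> t (hist M x \<omega> t)) (\<lambda>u. map_pmf (Pair u) (noise M (st M x \<omega> t) u)))"

definition traj :: "'w::countable mdp \<Rightarrow> nat \<Rightarrow> policy \<Rightarrow> (nat \<Rightarrow> nat \<times> 'w) measure" where
  "traj M x \<pi> = projective_family.lim UNIV
     (Ionescu_Tulcea.CI (step_kernel M x \<pi>) (\<lambda>_. count_space UNIV)) (\<lambda>_. count_space UNIV)"

lemma Ionescu_Tulcea_step_kernel:
  fixes M :: "'w::countable mdp"
  shows "Ionescu_Tulcea (step_kernel M x \<pi>) (\<lambda>_. count_space UNIV)"
proof (rule Ionescu_Tulcea.intro)
  fix i :: nat
  have eq: "PiM {0..<i} (\<lambda>_. count_space (UNIV :: (nat \<times> 'w) set)) =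
      count_space (PiE {0..<i} (\<lambda>_. UNIV))"
    by (rule count_space_PiM_finite) auto
  show "step_kernel M x \<pi> i \<in> measurable (PiM {0..<i} (\<lambda>_. count_space UNIV))
      (subprob_algebra (count_space UNIV))"
    unfolding eq by (auto simp: step_kernel_def measure_pmf_in_subprob_algebra)
qed (simp add: step_kernel_def measure_pmf.prob_space_axioms)

lemma prob_space_traj: "prob_space (traj M x \<pi>)"
proof -
  interpret Ionescu_Tulcea "step_kernel M x \<pi>" "\<lambda>_. count_space UNIV"
    by (rule Ionescu_Tulcea_step_kernel)
  let ?N = "PiM {} (\<lambda>_. count_space UNIV)" and ?r = "\<lambda>\<omega>. restrict \<omega> {}"
  have "?r \<in> measurable PF.lim ?N"
    by (auto simp: measurable_def space_PiM_empty sets_PiM_empty restrict_def vimage_def)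
  moreover have "prob_space (distr PF.lim ?N ?r)"
    by (simp only: distr_lim[OF finite.emptyI] PF.prob_space_P[OF finite.emptyI subset_UNIV])
  ultimately show ?thesis
    unfolding traj_def by (rule prob_space_distrD)
qed

definition h_d :: "nat \<Rightarrow> real" where
  "h_d x = (if x = 0 then 0 else 1)"

definition L_d :: "'w::countable mdp \<Rightarrow> real \<Rightarrow> nat \<Rightarrow> policy \<Rightarrow> real" where
  "L_d M \<gamma> x \<pi> = (LINT \<omega>|traj M x \<pi>. (\<Sum>t. \<gamma> ^ t * (1 - \<gamma>) * h_d (st M x \<omega> t)))"

definition Pi_hat :: "'w::countable mdp \<Rightarrow> real \<Rightarrow> real \<Rightarrow> nat \<Rightarrow> policy set" where
  "Pi_hat M \<gamma> \<epsilon> x = {\<pi> \<in> policies M. L_d M \<gamma> x \<pi> \<le> \<epsilon>}"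

text \<open>Histories take countably many values, so conditioning on \<open>H\<^sub>t\<close> is elementary
  conditioning on the event that \<open>H\<^sub>t\<close> has the observed value. On the null set of histories of
  probability \<open>0\<close> the conditional probability is \<open>0/0 = 0\<close>.\<close>

definition hopeless :: "'w::countable mdp \<Rightarrow> nat \<Rightarrow> policy \<Rightarrow> (nat \<Rightarrow> nat \<times> 'w) \<Rightarrow> nat \<Rightarrow> bool" where
  "hopeless M x \<pi> \<omega> t \<longleftrightarrow>
     \<P>(\<omega>' in traj M x \<pi>. (\<exists>t'\<ge>t. st M x \<omega>' t' = 0) \<bar> hist M x \<omega>' t = hist M x \<omega> t) = 0"

definition \<tau> :: "'w::countable mdp \<Rightarrow> nat \<Rightarrow> policy \<Rightarrow> (nat \<Rightarrow> nat \<times> 'w) \<Rightarrow> enat" where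
  "\<tau> M x \<pi> \<omega> = Inf (enat ` {t. hopeless M x \<pi> \<omega> t})"

definition total_cost :: "'w mdp \<Rightarrow> nat \<Rightarrow> (nat \<Rightarrow> nat \<times> 'w) \<Rightarrow> enat \<Rightarrow> ennreal" where
  "total_cost M x \<omega> T = (\<Sum>k. if enat k < T then ennreal (stage_cost M x \<omega> k) else 0)"

definition J_MCMP :: "'w::countable mdp \<Rightarrow> nat \<Rightarrow> policy \<Rightarrow> ennreal" where
  "J_MCMP M x \<pi> = (\<integral>\<^sup>+\<omega>. total_cost M x \<omega> (\<tau> M x \<pi> \<omega>) \<partial>traj M x \<pi>)"

text \<open>In the augmented process the label becomes \<open>Failed\<close>, for good, as soon as termination
  has become impossible given the history, and costs are charged only under \<open>Not_failed\<close>.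
  \<open>J_obj_eq_J_MCMP\<close> below confirms the identity by which this objective is evaluated.\<close>

datatype label = Not_failed | Failed

primrec label_at :: "'w::countable mdp \<Rightarrow> nat \<times> label \<Rightarrow> policy \<Rightarrow> (nat \<Rightarrow> nat \<times> 'w) \<Rightarrow> nat \<Rightarrow> label" where
  "label_at M xl \<pi> \<omega> 0 = (if hopeless M (fst xl) \<pi> \<omega> 0 then Failed else snd xl)"
| "label_at M xl \<pi> \<omega> (Suc t) =
     (if hopeless M (fst xl) \<pi> \<omega> (Suc t) then Failed else label_at M xl \<pi> \<omega> t)"

definition J_obj :: "'w::countable mdp \<Rightarrow> nat \<times> label \<Rightarrow> policy \<Rightarrow> ennreal" where
  "J_obj M xl \<pi> = (\<integral>\<^sup>+\<omega>. (\<Sum>t. if label_at M xl \<pi> \<omega> t = Not_failed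
      then ennreal (stage_cost M (fst xl) \<omega> t) else 0) \<partial>traj M (fst xl) \<pi>)"

lemma label_at_eq_Not_failed_iff:
  "label_at M (x, Not_failed) \<pi> \<omega> t = Not_failed \<longleftrightarrow> enat t < \<tau> M x \<pi> \<omega>"
proof -
  have "label_at M (x, Not_failed) \<pi> \<omega> t = Not_failed \<longleftrightarrow> (\<forall>j\<le>t. \<not> hopeless M x \<pi> \<omega> j)"
    by (induction t) (auto simp: le_Suc_eq)
  also have "\<dots> \<longleftrightarrow> enat (Suc t) \<le> \<tau> M x \<pi> \<omega>"
    by (auto simp: \<tau>_def le_Inf_iff Suc_le_eq not_le[symmetric])
  finally show ?thesis
    by (simp add: Suc_ile_eq)
qed

lemma J_obj_eq_J_MCMP: "J_obj M (x, Not_failed) \<pi> = J_MCMP M x \<pi>"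
  by (simp add: J_obj_def J_MCMP_def total_cost_def label_at_eq_Not_failed_iff cong: if_cong)

definition weights :: "(real \<times> real) set" where
  "weights = {(\<alpha>\<^sub>o, \<alpha>\<^sub>d). 0 \<le> \<alpha>\<^sub>o \<and> 0 \<le> \<alpha>\<^sub>d \<and> \<alpha>\<^sub>o + \<alpha>\<^sub>d = 1}"

definition J_mix :: "'w::countable mdp \<Rightarrow> real \<Rightarrow> real \<Rightarrow> real \<Rightarrow> nat \<times> label \<Rightarrow> real \<times> real \<Rightarrow> policy \<Rightarrow> ennreal" where
  "J_mix M \<gamma> \<epsilon> c xl \<alpha> \<pi> =
     ennreal (fst \<alpha>) * J_obj M xl \<pi> + ennreal (c / \<epsilon>) * ennreal (snd \<alpha>) * ennreal (L_d M \<gamma> (fst xl) \<pi>)"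

definition J_max :: "'w::countable mdp \<Rightarrow> real \<Rightarrow> real \<Rightarrow> real \<Rightarrow> nat \<times> label \<Rightarrow> policy \<Rightarrow> ennreal" where
  "J_max M \<gamma> \<epsilon> c xl \<pi> = (SUP \<alpha>\<in>weights. J_mix M \<gamma> \<epsilon> c xl \<alpha> \<pi>)"

definition minimax :: "'w::countable mdp \<Rightarrow> real \<Rightarrow> real \<Rightarrow> real \<Rightarrow> nat \<times> label \<Rightarrow> ennreal" where
  "minimax M \<gamma> \<epsilon> c xl = (INF \<pi>\<in>policies M. J_max M \<gamma> \<epsilon> c xl \<pi>)"

definition opt_policies :: "'w::countable mdp \<Rightarrow> real \<Rightarrow> real \<Rightarrow> real \<Rightarrow> nat \<times> label \<Rightarrow> policy set" where
  "opt_policies M \<gamma> \<epsilon> c xl =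
     {\<pi>. is_arg_min (J_max M \<gamma> \<epsilon> c xl) (\<lambda>\<pi>. \<pi> \<in> policies M) \<pi>}"

text \<open>The thresholds are elements of \<open>[0,\<infinity>]\<close>, with \<open>\<infinity>\<close> standing for the minimum of the
  empty set. At \<open>c = 0\<close> the constraint drops out of \<open>J_mix\<close>, so that \<open>c = 0\<close> is admissible
  in \<open>c_star\<close> whenever some policy, feasible or not, has objective \<open>0\<close>; \<open>c_star_pos\<close>
  ranges over \<open>c > 0\<close> only and does not have this degeneracy.\<close>

definition c_star :: "'w::countable mdp \<Rightarrow> real \<Rightarrow> real \<Rightarrow> nat \<Rightarrow> ennreal" where
  "c_star M \<gamma> \<epsilon> x = Inf (ennreal ` {c \<in> {0..}. minimax M \<gamma> \<epsilon> c (x, Not_failed) \<le> ennreal c})"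

definition c_star_pos :: "'w::countable mdp \<Rightarrow> real \<Rightarrow> real \<Rightarrow> nat \<Rightarrow> ennreal" where
  "c_star_pos M \<gamma> \<epsilon> x = Inf (ennreal ` {c \<in> {0<..}. minimax M \<gamma> \<epsilon> c (x, Not_failed) \<le> ennreal c})"

end

(*
  Histories take countably many values, so the behaviour of a policy is a point of a countable
  product of simplices, and every sequence of policies has a subsequence that converges at every
  history. The probability of a finite path is a finite product, hence continuous in the policy.
  "Not hopeless" means that some path of positive probability through the given history reaches 0;
  this is an open condition on the policy, so the label can only fail earlier in the limit. Fatou's
  lemma, applied to the sum over times and finite paths, therefore makes both the objective and the
  discounted constraint lower semicontinuous, and all minima are attained. Since the maximum over
  the weights is max(J, (c/eps) L), for c > 0 the minimax value is at most c iff some feasible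
  policy has objective at most c.
*)

theory Submission
  imports Defs
begin

section \<open>Cylinders of finite paths and their probabilities\<close>

text \<open>A finite path is encoded as a total function of which only the values below
  \<open>t\<close> matter, so that \<open>st\<close> and \<open>hist\<close> apply to it directly. A
  list \<open>p\<close> enters as \<open>(!) p\<close>.\<close>

definition cyl :: "nat \<Rightarrow> (nat \<Rightarrow> 'a) \<Rightarrow> (nat \<Rightarrow> 'a) set" where
  "cyl t a = {\<omega>. \<forall>k<t. \<omega> k = a k}"

definition path_weight :: "'w::countable mdp \<Rightarrow> nat \<Rightarrow> policy \<Rightarrow> nat \<Rightarrow> (nat \<Rightarrow> nat \<times> 'w) \<Rightarrow> real" where
  "path_weight M x \<pi> t a =
     (\<Prod>k<t. pmf (\<pi> k (hist M x a k)) (fst (a k)) *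
       pmf (noise M (st M x a k) (fst (a k))) (snd (a k)))"

lemma path_weight_nonneg: "0 \<le> path_weight M x \<pi> t a"
  by (simp add: path_weight_def prod_nonneg)

lemma st_cong: "(\<And>k. k < t \<Longrightarrow> \<omega> k = \<omega>' k) \<Longrightarrow> st M x \<omega> t = st M x \<omega>' t"
  by (induction t) auto

lemma stage_cost_cong:
  "(\<And>k. k < Suc t \<Longrightarrow> \<omega> k = \<omega>' k) \<Longrightarrow> stage_cost M x \<omega> t = stage_cost M x \<omega>' t"
  using st_cong[of t \<omega> \<omega>' M x] by (simp add: stage_cost_def)

lemma hist_cong:
  assumes "\<And>k. k < t \<Longrightarrow> \<omega> k = \<omega>' k"
  shows "hist M x \<omega> t = hist M x \<omega>' t"
proof -
  have "stage_cost M x \<omega> j = stage_cost M x \<omega>' j" if "j < t" for j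
    using assms that by (intro stage_cost_cong) auto
  moreover have "st M x \<omega> j = st M x \<omega>' j" if "j \<le> t" for j
    using assms that by (intro st_cong) auto
  ultimately show ?thesis
    using assms by (auto simp: hist_def intro!: sum.cong)
qed

text \<open>The action is recorded in the first component, so only the branch \<open>v = u\<close>
  of the mixture can produce \<open>(u, w)\<close>.\<close>

lemma pmf_bind_Pair: "pmf (bind_pmf p (\<lambda>u. map_pmf (Pair u) (q u))) (u, w) = pmf p u * pmf (q u) w"
proof -
  have "pmf (map_pmf (Pair v) (q v)) (u, w) = indicator {u} v * pmf (q u) w" for v
  proof (cases "v = u")
    case True
    then show ?thesis
      by (simp add: pmf_map_inj' inj_on_def)
  next
    case False
    then have "(u, w) \<notin> set_pmf (map_pmf (Pair v) (q v))" by auto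
    with False show ?thesis
      by (simp add: pmf_eq_0_set_pmf)
  qed
  then show ?thesis
    by (simp add: pmf_bind measure_pmf_single)
qed

lemma sets_space_traj:
  "sets (traj M x \<pi>) = sets (PiM UNIV (\<lambda>_. count_space UNIV))"
  "space (traj M x \<pi>) = UNIV"
proof -
  interpret Ionescu_Tulcea "step_kernel M x \<pi>" "\<lambda>_. count_space UNIV"
    by (rule Ionescu_Tulcea_step_kernel)
  show "sets (traj M x \<pi>) = sets (PiM UNIV (\<lambda>_. count_space UNIV))"
    "space (traj M x \<pi>) = UNIV"
    by (simp_all add: traj_def space_PiM)
qed

text \<open>A cylinder is the embedding of one point of the finite product over
  \<open>{0..<t}\<close>. Its mass is therefore that of the \<open>t\<close>-step composition of
  kernels at this point, and each step contributes one factor.\<close>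

lemma emeasure_traj_cyl: "emeasure (traj M x \<pi>) (cyl t a) = ennreal (path_weight M x \<pi> t a)"
proof -
  interpret Ionescu_Tulcea "step_kernel M x \<pi>" "\<lambda>_. count_space UNIV"
    by (rule Ionescu_Tulcea_step_kernel)
  let ?N = "\<lambda>t. PiM {0..<t} (\<lambda>_. count_space (UNIV :: (nat \<times> 'a) set))"
  have N: "?N t = count_space (PiE {0..<t} (\<lambda>_. UNIV))" for t :: nat
    by (rule count_space_PiM_finite) auto
  let ?r = "\<lambda>t. restrict a {0..<t}"
  have cyl: "cyl t a = prod_emb UNIV (\<lambda>_. count_space UNIV) {0..<t} {?r t}"
    by (auto simp: cyl_def prod_emb_def fun_eq_iff restrict_def space_PiM) metis
  \<comment> \<open>\<open>C 0 t\<close> starts from \<open>\<lambda>_. undefined\<close>, the only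
    point of the empty product.\<close>
  have C: "emeasure (C 0 t (\<lambda>_. undefined)) {?r t} = ennreal (path_weight M x \<pi> t a)" for t
  proof (induction t)
    case 0
    then show ?case
      by (simp add: path_weight_def restrict_def sets_PiM_empty emeasure_return)
  next
    case (Suc t)
    let ?s = "pmf (\<pi> t (hist M x a t)) (fst (a t)) * pmf (noise M (st M x a t) (fst (a t))) (snd (a t))"
    have u: "(\<lambda>_. undefined) \<in> space (?N 0)" by (auto simp: space_PiM)
    have sp: "space (C 0 t (\<lambda>_. undefined)) = PiE {0..<t} (\<lambda>_. UNIV)"
      using space_C[OF u, of t] by (simp add: N)
    have meas: "eP t \<in> measurable (C 0 t (\<lambda>_. undefined)) (subprob_algebra (?N (Suc t)))"
      using measurable_eP[of t] sets_C[OF u, of t] by (simp cong: measurable_cong_sets)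
    have "emeasure (C 0 (Suc t) (\<lambda>_. undefined)) {?r (Suc t)} =
        (\<integral>\<^sup>+\<omega>. emeasure (eP t \<omega>) {?r (Suc t)} \<partial>C 0 t (\<lambda>_. undefined))"
      using meas sp by (subst C.simps, subst emeasure_bind[where N = "?N (Suc t)"])
        (auto simp: N PiE_eq_empty_iff)
    \<comment> \<open>The extended path \<open>?r (Suc t)\<close> can be reached only from
      \<open>?r t\<close>, and from there only by appending the pair \<open>a t\<close>.\<close>
    also have "\<dots> = (\<integral>\<^sup>+\<omega>. ennreal ?s * indicator {?r t} \<omega> \<partial>C 0 t (\<lambda>_. undefined))"
    proof (rule nn_integral_cong)
      fix \<omega> assume "\<omega> \<in> space (C 0 t (\<lambda>_. undefined))"
      then have w: "\<omega> \<in> PiE {0..<t} (\<lambda>_. UNIV)" by (simp add: sp)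
      have "emeasure (eP t \<omega>) {?r (Suc t)} =
          emeasure (step_kernel M x \<pi> t \<omega>) (fun_upd \<omega> t -` {?r (Suc t)})"
        using w by (subst emeasure_eP) (auto simp: N vimage_def)
      also have "\<dots> = ennreal ?s * indicator {?r t} \<omega>"
      proof (cases "\<omega> = ?r t")
        case True
        have "fun_upd \<omega> t v = ?r (Suc t) \<longleftrightarrow> v = a t" for v
        proof
          assume "fun_upd \<omega> t v = ?r (Suc t)"
          from fun_cong[OF this, of t] show "v = a t" by simp
        qed (auto simp: True fun_eq_iff)
        then have *: "fun_upd \<omega> t -` {?r (Suc t)} = {a t}" by auto
        have "hist M x \<omega> t = hist M x a t" "st M x \<omega> t = st M x a t"
          using True by (auto intro!: hist_cong st_cong)
        then have "emeasure (step_kernel M x \<pi> t \<omega>) {a t} = ?s"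
          using pmf_bind_Pair[of "\<pi> t (hist M x a t)" "noise M (st M x a t)" "fst (a t)" "snd (a t)"]
          by (simp add: step_kernel_def emeasure_pmf_single)
        then show ?thesis unfolding * using True by simp
      next
        case False
        have "fun_upd \<omega> t v \<noteq> ?r (Suc t)" for v
        proof
          assume eq: "fun_upd \<omega> t v = ?r (Suc t)"
          \<comment> \<open>For \<open>k \<ge> t\<close> both sides are \<open>undefined\<close>,
            since \<open>\<omega>\<close> is extensional on \<open>{0..<t}\<close>.\<close>
          have "\<omega> k = ?r t k" for k
            using fun_cong[OF eq, of k] w by (cases "k < t"; cases "k = t") (auto simp: PiE_def extensional_def)
          then have "\<omega> = ?r t" by (rule ext)
          with False show False ..
        qed
        then have "fun_upd \<omega> t -` {?r (Suc t)} = {}" by auto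
        then show ?thesis using False by simp
      qed
      finally show "emeasure (eP t \<omega>) {?r (Suc t)} = ennreal ?s * indicator {?r t} \<omega>" .
    qed
    also have "\<dots> = ennreal ?s * emeasure (C 0 t (\<lambda>_. undefined)) {?r t}"
      using sets_C[OF u, of t] by (subst nn_integral_cmult_indicator) (auto simp: N)
    finally show ?case
      unfolding Suc.IH path_weight_def lessThan_Suc
      by (subst prod.insert) (auto simp: ennreal_mult prod_nonneg)
  qed
  show ?thesis
    unfolding cyl traj_def
    by (subst lim, simp, simp add: N, subst emeasure_CI[where n = t])
       (simp_all add: C prod_emb_id N)
qed

lemma sets_cyl: "cyl t a \<in> sets (traj M x \<pi>)"
proof -
  have "cyl t a = prod_emb UNIV (\<lambda>_. count_space UNIV) {..<t} (PiE {..<t} (\<lambda>k. {a k}))"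
    by (auto simp: cyl_def prod_emb_PiE PiE_iff split: if_splits)
  also have "\<dots> \<in> sets (PiM UNIV (\<lambda>_. count_space UNIV))"
    by (intro sets_PiM_I) auto
  finally show ?thesis by (simp add: sets_space_traj)
qed

lemma vimage_path: "(\<lambda>\<omega>. map \<omega> [0..<t]) -` {p} = (if length p = t then cyl t ((!) p) else {})"
proof (cases "length p = t")
  case True
  then have "map \<omega> [0..<t] = p \<longleftrightarrow> (\<forall>k<t. \<omega> k = p ! k)" for \<omega>
    unfolding list_eq_iff_nth_eq by simp
  with True show ?thesis by (simp add: cyl_def vimage_def)
qed auto

text \<open>Lists of pairs form a countable type, so preimages of single lists suffice, and these
  are cylinders or empty.\<close>

lemma measurable_path:
  fixes M :: "'w::countable mdp"
  shows "(\<lambda>\<omega>. map \<omega> [0..<t]) \<in> measurable (traj M x \<pi>) (count_space UNIV)"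
  unfolding measurable_count_space_eq2_countable
  by (auto simp: vimage_path sets_space_traj(2) sets_cyl)

text \<open>Such a function factors through the prefix of length \<open>t\<close>, an element of a
  discrete space on which every function is measurable.\<close>

lemma measurable_finite_horizon:
  fixes M :: "'w::countable mdp"
  assumes "\<And>\<omega> \<omega>'. (\<And>k. k < t \<Longrightarrow> \<omega> k = \<omega>' k) \<Longrightarrow> f \<omega> = f \<omega>'" and "space N = UNIV"
  shows "f \<in> measurable (traj M x \<pi>) N"
proof -
  have "f = (\<lambda>p. f ((!) p)) \<circ> (\<lambda>\<omega>. map \<omega> [0..<t])"
  proof
    fix \<omega>
    show "f \<omega> = ((\<lambda>p. f ((!) p)) \<circ> (\<lambda>\<omega>. map \<omega> [0..<t])) \<omega>"
      unfolding comp_def by (rule assms(1)) simp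
  qed
  also have "\<dots> \<in> measurable (traj M x \<pi>) N"
    by (rule measurable_comp[OF measurable_path]) (auto simp: assms(2))
  finally show ?thesis .
qed

text \<open>The cylinders of length \<open>t\<close> partition the sample space and \<open>f\<close>
  is constant on each. On the right the policy enters only through the path weights, while the
  measure is a fixed counting measure.\<close>

lemma nn_integral_traj_finite_horizon:
  fixes M :: "'w::countable mdp" and f :: "(nat \<Rightarrow> nat \<times> 'w) \<Rightarrow> ennreal"
  assumes f: "\<And>\<omega> \<omega>'. (\<And>k. k < t \<Longrightarrow> \<omega> k = \<omega>' k) \<Longrightarrow> f \<omega> = f \<omega>'"
  shows "(\<integral>\<^sup>+\<omega>. f \<omega> \<partial>traj M x \<pi>) =
    (\<integral>\<^sup>+p. f ((!) p) * ennreal (path_weight M x \<pi> t ((!) p)) \<partial>count_space {p. length p = t})"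
proof -
  have "(\<integral>\<^sup>+\<omega>. f \<omega> \<partial>traj M x \<pi>) =
     (\<integral>\<^sup>+\<omega>. \<integral>\<^sup>+p. f ((!) p) * indicator (cyl t ((!) p)) \<omega> \<partial>count_space {p. length p = t} \<partial>traj M x \<pi>)"
  proof (rule nn_integral_cong)
    fix \<omega> :: "nat \<Rightarrow> nat \<times> 'w"
    let ?p = "map \<omega> [0..<t]"
    \<comment> \<open>Only the prefix of \<open>\<omega>\<close> itself contributes to the
      sum.\<close>
    have "(\<integral>\<^sup>+p. f ((!) p) * indicator (cyl t ((!) p)) \<omega> \<partial>count_space {p. length p = t}) =
       (\<Sum>p\<in>{?p}. f ((!) p) * indicator (cyl t ((!) p)) \<omega>)"
      by (intro nn_integral_count_space')
         (auto simp: cyl_def indicator_def intro: nth_equalityI)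
    also have "\<dots> = f \<omega>"
      by (auto simp: cyl_def indicator_def intro!: f)
    finally show "f \<omega> = (\<integral>\<^sup>+p. f ((!) p) * indicator (cyl t ((!) p)) \<omega> \<partial>count_space {p. length p = t})"
      by simp
  qed
  also have "\<dots> = (\<integral>\<^sup>+p. \<integral>\<^sup>+\<omega>. f ((!) p) * indicator (cyl t ((!) p)) \<omega> \<partial>traj M x \<pi> \<partial>count_space {p. length p = t})"
    by (intro nn_integral_count_space_nn_integral) (auto intro!: borel_measurable_times_ennreal borel_measurable_indicator sets_cyl)
  also have "\<dots> = (\<integral>\<^sup>+p. f ((!) p) * ennreal (path_weight M x \<pi> t ((!) p)) \<partial>count_space {p. length p = t})"
    by (intro nn_integral_cong)
       (simp add: nn_integral_cmult_indicator sets_cyl emeasure_traj_cyl)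
  finally show ?thesis .
qed

section \<open>Hopelessness in terms of finite paths\<close>

text \<open>The event of reaching 0 through the given history is a countable union of cylinders,
  hence null iff each of them has weight 0. The condition becomes the positivity of one finite
  product.\<close>

lemma not_hopeless_iff:
  fixes M :: "'w::countable mdp"
  shows "\<not> hopeless M x \<pi> \<omega> t \<longleftrightarrow>
    (\<exists>n\<ge>t. \<exists>a. st M x a n = 0 \<and> hist M x a t = hist M x \<omega> t \<and> 0 < path_weight M x \<pi> n a)"
proof -
  let ?T = "traj M x \<pi>"
  interpret prob_space ?T by (rule prob_space_traj)
  have [measurable]: "Measurable.pred ?T (\<lambda>\<omega>'. st M x \<omega>' n = 0)" for n
    by (rule measurable_finite_horizon[where t = n], subst st_cong, assumption) simp_all
  have [measurable]: "Measurable.pred ?T (\<lambda>\<omega>'. hist M x \<omega>' t = hist M x \<omega> t)"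
    by (rule measurable_finite_horizon[where t = t], subst hist_cong, assumption) simp_all
  let ?A = "{\<omega>'\<in>space ?T. (\<exists>n\<ge>t. st M x \<omega>' n = 0) \<and> hist M x \<omega>' t = hist M x \<omega> t}"
  \<comment> \<open>A path in \<open>?I\<close> stops at a time when it is in state 0; different
    lengths serve the different hitting times.\<close>
  let ?I = "{p. length p \<ge> t \<and> st M x ((!) p) (length p) = 0 \<and> hist M x ((!) p) t = hist M x \<omega> t}"
  have A: "?A = (\<Union>p\<in>?I. cyl (length p) ((!) p))"
  proof (intro equalityI subsetI)
    fix \<omega>' assume "\<omega>' \<in> ?A"
    then obtain n where n: "n \<ge> t" "st M x \<omega>' n = 0" "hist M x \<omega>' t = hist M x \<omega> t" by auto
    let ?p = "map \<omega>' [0..<n]"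
    have "st M x ((!) ?p) n = st M x \<omega>' n" "hist M x ((!) ?p) t = hist M x \<omega>' t"
      using n(1) by (auto intro!: st_cong hist_cong)
    with n have "?p \<in> ?I" by simp
    moreover have "\<omega>' \<in> cyl (length ?p) ((!) ?p)" by (auto simp: cyl_def)
    ultimately show "\<omega>' \<in> (\<Union>p\<in>?I. cyl (length p) ((!) p))" by blast
  next
    fix \<omega>' assume "\<omega>' \<in> (\<Union>p\<in>?I. cyl (length p) ((!) p))"
    then obtain p where p: "p \<in> ?I" "\<omega>' \<in> cyl (length p) ((!) p)" by blast
    have eq: "\<omega>' k = p ! k" if "k < length p" for k
      using p(2) that by (simp add: cyl_def)
    have "st M x \<omega>' (length p) = st M x ((!) p) (length p)"
      by (rule st_cong) (rule eq)
    moreover have "hist M x \<omega>' t = hist M x ((!) p) t"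
      using p(1) by (intro hist_cong eq) simp
    ultimately have "t \<le> length p \<and> st M x \<omega>' (length p) = 0" "hist M x \<omega>' t = hist M x \<omega> t"
      using p(1) by simp_all
    then show "\<omega>' \<in> ?A"
      unfolding sets_space_traj(2) by blast
  qed
  \<comment> \<open>Since \<open>?A\<close> lies in the conditioning event,
    \<open>prob ?A = 0\<close> whenever that event is null. The default value \<open>0/0 = 0\<close>
    thus agrees with the criterion \<open>prob ?A = 0\<close>.\<close>
  have le: "prob ?A \<le> prob {\<omega>'\<in>space ?T. hist M x \<omega>' t = hist M x \<omega> t}"
    by (intro finite_measure_mono) auto
  have "hopeless M x \<pi> \<omega> t \<longleftrightarrow> prob ?A = 0"
    unfolding hopeless_def cond_prob_def
    using le by (auto simp: measure_le_0_iff)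
  also have "\<dots> \<longleftrightarrow> ?A \<in> null_sets ?T"
    by (simp add: null_sets_def emeasure_eq_measure)
  also have "\<dots> \<longleftrightarrow> (\<forall>p\<in>?I. path_weight M x \<pi> (length p) ((!) p) = 0)"
  proof
    assume null: "?A \<in> null_sets ?T"
    show "\<forall>p\<in>?I. path_weight M x \<pi> (length p) ((!) p) = 0"
    proof
      fix p assume "p \<in> ?I"
      then have "cyl (length p) ((!) p) \<in> null_sets ?T"
        using A by (intro null_sets_subset[OF null sets_cyl]) blast
      then show "path_weight M x \<pi> (length p) ((!) p) = 0"
        using path_weight_nonneg[of M x \<pi>] by (auto simp: null_sets_def emeasure_traj_cyl ennreal_eq_0_iff intro: antisym)
    qed
  next
    assume "\<forall>p\<in>?I. path_weight M x \<pi> (length p) ((!) p) = 0"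
    then show "?A \<in> null_sets ?T"
      unfolding A by (intro null_sets_UN') (auto simp: null_sets_def emeasure_traj_cyl sets_cyl)
  qed
  finally have "\<not> hopeless M x \<pi> \<omega> t \<longleftrightarrow> (\<exists>p\<in>?I. 0 < path_weight M x \<pi> (length p) ((!) p))"
    using path_weight_nonneg[of M x \<pi>] by (auto simp: less_le)
  also have "\<dots> \<longleftrightarrow> (\<exists>n\<ge>t. \<exists>a. st M x a n = 0 \<and> hist M x a t = hist M x \<omega> t \<and> 0 < path_weight M x \<pi> n a)"
  proof
    assume "\<exists>n\<ge>t. \<exists>a. st M x a n = 0 \<and> hist M x a t = hist M x \<omega> t \<and> 0 < path_weight M x \<pi> n a"
    then obtain n a where a: "n \<ge> t" "st M x a n = 0" "hist M x a t = hist M x \<omega> t" "0 < path_weight M x \<pi> n a"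
      by blast
    \<comment> \<open>Truncation to a list preserves the states and histories up to time
      \<open>n\<close>, and with them the weight.\<close>
    let ?p = "map a [0..<n]"
    have h: "st M x ((!) ?p) k = st M x a k" "hist M x ((!) ?p) k = hist M x a k" if "k \<le> n" for k
      using that by (auto intro!: st_cong hist_cong)
    have "path_weight M x \<pi> n ((!) ?p) = path_weight M x \<pi> n a"
      using h by (auto simp: path_weight_def intro!: prod.cong)
    with a h[of n] h[of t] show "\<exists>p\<in>?I. 0 < path_weight M x \<pi> (length p) ((!) p)"
      by (intro bexI[of _ ?p]) auto
  qed auto
  finally show ?thesis .
qed

section \<open>Convergence of policies and lower semicontinuity\<close>

text \<open>Only histories generated from \<open>x\<close> are tested. They are countable in number,
  and the path weights from \<open>x\<close> evaluate policies at no others.\<close>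

definition policy_tendsto :: "'w mdp \<Rightarrow> nat \<Rightarrow> (nat \<Rightarrow> policy) \<Rightarrow> policy \<Rightarrow> bool" where
  "policy_tendsto M x \<pi>s \<pi> \<longleftrightarrow>
     (\<forall>t \<omega> u. (\<lambda>n. pmf (\<pi>s n t (hist M x \<omega> t)) u) \<longlonglongrightarrow> pmf (\<pi> t (hist M x \<omega> t)) u)"

lemma path_weight_tendsto:
  assumes "policy_tendsto M x \<pi>s \<pi>"
  shows "(\<lambda>n. path_weight M x (\<pi>s n) t a) \<longlonglongrightarrow> path_weight M x \<pi> t a"
  using assms unfolding path_weight_def policy_tendsto_def
  by (intro tendsto_prod tendsto_mult tendsto_const) blast

text \<open>A path of positive weight under the limit keeps positive weight eventually. The converse
  may fail, because positive weights can tend to 0.\<close>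

lemma eventually_not_hopeless:
  fixes M :: "'w::countable mdp"
  assumes conv: "policy_tendsto M x \<pi>s \<pi>" and h: "\<not> hopeless M x \<pi> \<omega> t"
  shows "\<forall>\<^sub>F n in sequentially. \<not> hopeless M x (\<pi>s n) \<omega> t"
proof -
  from h obtain m a where a: "t \<le> m" "st M x a m = 0" "hist M x a t = hist M x \<omega> t"
      and "0 < path_weight M x \<pi> m a"
    unfolding not_hopeless_iff by blast
  then have "\<forall>\<^sub>F n in sequentially. 0 < path_weight M x (\<pi>s n) m a"
    by (intro order_tendstoD(1)[OF path_weight_tendsto[OF conv]])
  then show ?thesis
    by eventually_elim (use a not_hopeless_iff in blast)
qed

text \<open>Both the integrand and the measure vary with the policy. Writing the integral as a
  double sum over times and paths moves all dependence on the policy into the summands, where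
  Fatou's lemma applies.\<close>

lemma nn_integral_traj_Fatou:
  fixes M :: "'w::countable mdp" and F :: "policy \<Rightarrow> nat \<Rightarrow> (nat \<Rightarrow> nat \<times> 'w) \<Rightarrow> ennreal"
  assumes conv: "policy_tendsto M x \<pi>s \<pi>"
    and dep: "\<And>\<pi> t \<omega> \<omega>'. (\<And>k. k < Suc t \<Longrightarrow> \<omega> k = \<omega>' k) \<Longrightarrow> F \<pi> t \<omega> = F \<pi> t \<omega>'"
    and fin: "\<And>\<pi> t \<omega>. F \<pi> t \<omega> < \<top>"
    and ev: "\<And>t \<omega>. \<forall>\<^sub>F n in sequentially. F \<pi> t \<omega> \<le> F (\<pi>s n) t \<omega>"
  shows "(\<integral>\<^sup>+\<omega>. (\<Sum>t. F \<pi> t \<omega>) \<partial>traj M x \<pi>) \<le>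
     liminf (\<lambda>n. \<integral>\<^sup>+\<omega>. (\<Sum>t. F (\<pi>s n) t \<omega>) \<partial>traj M x (\<pi>s n))"
proof -
  \<comment> \<open>Paths have length \<open>Suc t\<close> because the cost at time \<open>t\<close>
    depends on \<open>\<omega> t\<close> as well.\<close>
  define G where "G \<pi> t p = F \<pi> t ((!) p) * ennreal (path_weight M x \<pi> (Suc t) ((!) p))" for \<pi> t p
  have repr: "(\<integral>\<^sup>+\<omega>. (\<Sum>t. F \<pi> t \<omega>) \<partial>traj M x \<pi>) =
      (\<integral>\<^sup>+t. \<integral>\<^sup>+p. G \<pi> t p \<partial>count_space {p. length p = Suc t} \<partial>count_space UNIV)" for \<pi>
  proof -
    have meas: "F \<pi> t \<in> borel_measurable (traj M x \<pi>)" for t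
      by (rule measurable_finite_horizon[where t = "Suc t"], rule dep) simp_all
    have int: "(\<integral>\<^sup>+\<omega>. F \<pi> t \<omega> \<partial>traj M x \<pi>) =
        (\<integral>\<^sup>+p. G \<pi> t p \<partial>count_space {p. length p = Suc t})" for t
      unfolding G_def by (rule nn_integral_traj_finite_horizon, rule dep) simp
    show ?thesis
      unfolding nn_integral_suminf[OF meas] int nn_integral_count_space_nat ..
  qed
  have G: "G \<pi> t p \<le> liminf (\<lambda>n. G (\<pi>s n) t p)" for t p
  proof -
    \<comment> \<open>First \<open>F \<pi>\<close> is kept fixed and only the weights converge; by
      \<open>fin\<close> the constant factor is finite, so multiplication by it is continuous.
      Afterwards \<open>ev\<close> replaces \<open>F \<pi>\<close> by \<open>F (\<pi>s n)\<close> at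
      the price of an inequality.\<close>
    have "(\<lambda>n. F \<pi> t ((!) p) * ennreal (path_weight M x (\<pi>s n) (Suc t) ((!) p))) \<longlonglongrightarrow> G \<pi> t p"
      unfolding G_def
      by (intro ennreal_tendsto_cmult fin tendsto_ennrealI path_weight_tendsto conv)
    then have "G \<pi> t p = liminf (\<lambda>n. F \<pi> t ((!) p) * ennreal (path_weight M x (\<pi>s n) (Suc t) ((!) p)))"
      by (intro lim_imp_Liminf[symmetric]) auto
    also have "\<dots> \<le> liminf (\<lambda>n. G (\<pi>s n) t p)"
      unfolding G_def using ev[of t "(!) p"]
      by (intro Liminf_mono) (auto elim!: eventually_mono intro: mult_right_mono)
    finally show ?thesis .
  qed
  \<comment> \<open>Fatou's lemma is used twice, for the sum over paths and then for the sum over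
    times.\<close>
  have "(\<integral>\<^sup>+t. \<integral>\<^sup>+p. G \<pi> t p \<partial>count_space {p. length p = Suc t} \<partial>count_space UNIV) \<le>
      (\<integral>\<^sup>+t. liminf (\<lambda>n. \<integral>\<^sup>+p. G (\<pi>s n) t p \<partial>count_space {p. length p = Suc t}) \<partial>count_space UNIV)"
    by (intro nn_integral_mono order_trans[OF nn_integral_mono[OF G] nn_integral_liminf]) simp
  also have "\<dots> \<le> liminf (\<lambda>n. \<integral>\<^sup>+t. \<integral>\<^sup>+p. G (\<pi>s n) t p \<partial>count_space {p. length p = Suc t} \<partial>count_space UNIV)"
    by (intro nn_integral_liminf) simp
  finally show ?thesis unfolding repr .
qed

lemma J_obj_lsc:
  fixes M :: "'w::countable mdp"
  assumes conv: "policy_tendsto M x \<pi>s \<pi>"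
  shows "J_obj M (x, Not_failed) \<pi> \<le> liminf (\<lambda>n. J_obj M (x, Not_failed) (\<pi>s n))"
proof -
  \<comment> \<open>The quantifier ranges over the finite set \<open>{..t}\<close>, so that finitely
    many eventual statements can be combined.\<close>
  have iff: "label_at M (x, Not_failed) \<pi> \<omega> t = Not_failed \<longleftrightarrow> (\<forall>j\<in>{..t}. \<not> hopeless M x \<pi> \<omega> j)"
    for \<pi> \<omega> t
    by (induction t) (auto simp: le_Suc_eq)
  show ?thesis
    unfolding J_obj_def fst_conv iff
  proof (rule nn_integral_traj_Fatou[OF conv])
    fix \<pi>' :: policy and t :: nat and \<omega> \<omega>' :: "nat \<Rightarrow> nat \<times> 'w"
    assume eq: "\<And>k. k < Suc t \<Longrightarrow> \<omega> k = \<omega>' k"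
    have "hopeless M x \<pi>' \<omega> j = hopeless M x \<pi>' \<omega>' j" if "j \<le> t" for j
      unfolding hopeless_def using hist_cong[of j \<omega> \<omega>' M x] eq that by simp
    moreover have "stage_cost M x \<omega> t = stage_cost M x \<omega>' t"
      by (rule stage_cost_cong) (rule eq)
    ultimately show "(if \<forall>j\<in>{..t}. \<not> hopeless M x \<pi>' \<omega> j then ennreal (stage_cost M x \<omega> t) else 0) =
        (if \<forall>j\<in>{..t}. \<not> hopeless M x \<pi>' \<omega>' j then ennreal (stage_cost M x \<omega>' t) else 0)"
      by simp
  next
    fix t \<omega>
    show "\<forall>\<^sub>F n in sequentially.
        (if \<forall>j\<in>{..t}. \<not> hopeless M x \<pi> \<omega> j then ennreal (stage_cost M x \<omega> t) else 0) \<le>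
        (if \<forall>j\<in>{..t}. \<not> hopeless M x (\<pi>s n) \<omega> j then ennreal (stage_cost M x \<omega> t) else 0)"
    proof (cases "\<forall>j\<in>{..t}. \<not> hopeless M x \<pi> \<omega> j")
      case True
      then have "\<forall>\<^sub>F n in sequentially. \<forall>j\<in>{..t}. \<not> hopeless M x (\<pi>s n) \<omega> j"
        by (intro eventually_ball_finite ballI eventually_not_hopeless[OF conv]) auto
      then show ?thesis by eventually_elim auto
    next
      case False
      show ?thesis unfolding if_not_P[OF False] by simp
    qed
  qed simp
qed

text \<open>The discounted sum is bounded by a geometric series with sum 1, hence integrable. Its
  Bochner integral then equals the nonnegative integral required for
  \<open>nn_integral_traj_Fatou\<close>.\<close>

lemma ennreal_L_d:
  fixes M :: "'w::countable mdp"
  assumes "0 < \<gamma>" "\<gamma> < 1"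
  shows "ennreal (L_d M \<gamma> x \<pi>) =
    (\<integral>\<^sup>+\<omega>. (\<Sum>t. ennreal (\<gamma> ^ t * (1 - \<gamma>) * h_d (st M x \<omega> t))) \<partial>traj M x \<pi>)"
proof -
  interpret prob_space "traj M x \<pi>" by (rule prob_space_traj)
  let ?f = "\<lambda>\<omega> t. \<gamma> ^ t * (1 - \<gamma>) * h_d (st M x \<omega> t)"
  have nonneg: "0 \<le> ?f \<omega> t" and le: "?f \<omega> t \<le> \<gamma> ^ t * (1 - \<gamma>)" for \<omega> t
    using assms by (auto simp: h_d_def)
  have geo: "(\<lambda>t. \<gamma> ^ t * (1 - \<gamma>)) sums 1"
    using sums_mult2[OF geometric_sums[of \<gamma>], of "1 - \<gamma>"] assms by simp
  have summable: "summable (?f \<omega>)" for \<omega>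
    using nonneg le by (intro summable_comparison_test'[OF sums_summable[OF geo], of 0]) auto
  have le1: "suminf (?f \<omega>) \<le> 1" for \<omega>
    using suminf_le[OF le summable sums_summable[OF geo]] sums_unique[OF geo] by simp
  have nonneg': "0 \<le> suminf (?f \<omega>)" for \<omega>
    by (intro suminf_nonneg summable nonneg)
  have [measurable]: "(\<lambda>\<omega>. ?f \<omega> t) \<in> borel_measurable (traj M x \<pi>)" for t
    by (rule measurable_finite_horizon[where t = t], subst st_cong, assumption) simp_all
  have "integrable (traj M x \<pi>) (\<lambda>\<omega>. suminf (?f \<omega>))"
    using nonneg' le1 by (intro integrable_const_bound[where B = 1]) auto
  then show ?thesis
    unfolding L_d_def
    by (subst nn_integral_eq_integral[symmetric])
       (auto simp: nonneg nonneg' suminf_ennreal2 summable intro!: nn_integral_cong)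
qed

lemma L_d_lsc:
  fixes M :: "'w::countable mdp"
  assumes conv: "policy_tendsto M x \<pi>s \<pi>" and "0 < \<gamma>" "\<gamma> < 1"
  shows "ennreal (L_d M \<gamma> x \<pi>) \<le> liminf (\<lambda>n. ennreal (L_d M \<gamma> x (\<pi>s n)))"
  unfolding ennreal_L_d[OF assms(2,3)]
proof (rule nn_integral_traj_Fatou[OF conv])
  fix t :: nat and \<omega> \<omega>' :: "nat \<Rightarrow> nat \<times> 'w"
  assume eq: "\<And>k. k < Suc t \<Longrightarrow> \<omega> k = \<omega>' k"
  have "st M x \<omega> t = st M x \<omega>' t"
    by (rule st_cong) (simp add: eq)
  then show "ennreal (\<gamma> ^ t * (1 - \<gamma>) * h_d (st M x \<omega> t)) =
      ennreal (\<gamma> ^ t * (1 - \<gamma>) * h_d (st M x \<omega>' t))"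
    by simp
qed simp_all

section \<open>Sequential compactness of the set of policies\<close>

text \<open>Compactness of a product of unit intervals yields a pointwise limit. The common finite
  support \<open>A\<close> ensures that no mass is lost, so the limits are again probability mass
  functions.\<close>

lemma pmf_seq_compact:
  fixes p :: "nat \<Rightarrow> 's \<Rightarrow> 'b::countable pmf"
  assumes "countable S" "finite A" and p: "\<And>n s. s \<in> S \<Longrightarrow> set_pmf (p n s) \<subseteq> A"
  obtains r q where "strict_mono (r :: nat \<Rightarrow> nat)"
    "\<And>s. s \<in> S \<Longrightarrow> set_pmf (q s) \<subseteq> A"
    "\<And>s u. s \<in> S \<Longrightarrow> (\<lambda>n. pmf (p (r n) s) u) \<longlonglongrightarrow> pmf (q s) u"
proof -
  \<comment> \<open>Enumerating \<open>S\<close> by natural numbers gives functions on a countable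
    type. These form a metric space, where compactness yields convergent subsequences.\<close>
  define X :: "nat \<Rightarrow> nat \<times> 'b \<Rightarrow> real"
    where "X n = (\<lambda>(i, u). pmf (p n (from_nat_into S i)) u)" for n
  have "compact (PiE UNIV (\<lambda>_. {0..1}) :: (nat \<times> 'b \<Rightarrow> real) set)"
    using compactin_PiE[of "\<lambda>_. euclidean" UNIV "\<lambda>_::nat \<times> 'b. {0..1::real}"]
    by (simp add: euclidean_product_topology)
  moreover have "X n \<in> PiE UNIV (\<lambda>_. {0..1})" for n
    by (auto simp: X_def pmf_le_1)
  ultimately obtain l r where r: "strict_mono (r :: nat \<Rightarrow> nat)" and l: "(X \<circ> r) \<longlonglongrightarrow> l"
    unfolding compact_def by metis
  have l_coord: "(\<lambda>n. X (r n) i) \<longlonglongrightarrow> l i" for i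
    using continuous_on_tendsto_compose[OF continuous_on_product_coordinates[of i] l]
    by (simp add: comp_def)
  define q where "q s = embed_pmf (\<lambda>u. l (to_nat_on S s, u))" for s
  have lim: "(\<lambda>n. pmf (p (r n) s) u) \<longlonglongrightarrow> l (to_nat_on S s, u)" if "s \<in> S" for s u
    using l_coord[of "(to_nat_on S s, u)"] that \<open>countable S\<close> by (simp add: X_def)
  have nonneg: "0 \<le> l (to_nat_on S s, u)" if "s \<in> S" for s u
    using lim[OF that] by (rule LIMSEQ_le_const) auto
  have supp: "l (to_nat_on S s, u) = 0" if "s \<in> S" "u \<notin> A" for s u
  proof -
    have "pmf (p n s) u = 0" for n
      using p[OF that(1)] that(2) by (auto simp: pmf_eq_0_set_pmf)
    then show ?thesis
      using LIMSEQ_unique[OF lim[OF that(1), of u]] by simp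
  qed
  have sum1: "(\<integral>\<^sup>+u. ennreal (l (to_nat_on S s, u)) \<partial>count_space UNIV) = 1" if "s \<in> S" for s
  proof -
    have "(\<Sum>u\<in>A. pmf (p n s) u) = 1" for n
      by (rule sum_pmf_eq_1[OF \<open>finite A\<close> p[OF that]])
    then have "(\<Sum>u\<in>A. l (to_nat_on S s, u)) = 1"
      using LIMSEQ_unique[OF tendsto_sum[where I = A, OF lim[OF that]]] by simp
    moreover have "(\<integral>\<^sup>+u. ennreal (l (to_nat_on S s, u)) \<partial>count_space UNIV) =
        (\<Sum>u\<in>A. ennreal (l (to_nat_on S s, u)))"
      using supp[OF that] \<open>finite A\<close> by (intro nn_integral_count_space') auto
    ultimately show ?thesis
      by (simp add: sum_ennreal nonneg[OF that])
  qed
  have q: "pmf (q s) u = l (to_nat_on S s, u)" if "s \<in> S" for s u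
    unfolding q_def by (intro pmf_embed_pmf nonneg sum1 that)
  show ?thesis
  proof (rule that[OF r])
    show "set_pmf (q s) \<subseteq> A" if "s \<in> S" for s
    proof
      fix u assume "u \<in> set_pmf (q s)"
      then have "l (to_nat_on S s, u) \<noteq> 0"
        by (simp add: set_pmf_iff q[OF that])
      then show "u \<in> A" using supp[OF that] by blast
    qed
    show "(\<lambda>n. pmf (p (r n) s) u) \<longlonglongrightarrow> pmf (q s) u" if "s \<in> S" for s u
      using lim[OF that] q[OF that] by simp
  qed
qed

text \<open>A history at time \<open>t\<close> is determined by the list of the first
  \<open>t\<close> pairs, and there are countably many such lists.\<close>

lemma countable_histories:
  fixes M :: "'w::countable mdp"
  shows "countable (range (\<lambda>(t, \<omega>). (t, hist M x \<omega> t)))"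
proof (rule countable_subset)
  show "range (\<lambda>(t, \<omega>). (t, hist M x \<omega> t)) \<subseteq>
      range (\<lambda>(t, p). (t, hist M x ((!) p) t))"
  proof
    fix s assume "s \<in> range (\<lambda>(t, \<omega>). (t, hist M x \<omega> t))"
    then obtain z where "s = (\<lambda>(t, \<omega>). (t, hist M x \<omega> t)) z" by (rule rangeE)
    then obtain t \<omega> where s: "s = (t, hist M x \<omega> t)" by (cases z) simp
    also have "hist M x \<omega> t = hist M x ((!) (map \<omega> [0..<t])) t"
      by (rule hist_cong) simp
    finally show "s \<in> range (\<lambda>(t, p). (t, hist M x ((!) p) t))"
      by (intro range_eqI[of _ _ "(t, map \<omega> [0..<t])"]) simp
  qed
qed simp

lemma policies_seq_compact:
  fixes M :: "'w::countable mdp"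
  assumes "\<And>n. \<pi>s n \<in> policies M" "1 \<le> NC M"
  obtains r \<pi> where "strict_mono (r :: nat \<Rightarrow> nat)" "\<pi> \<in> policies M" "policy_tendsto M x (\<pi>s \<circ> r) \<pi>"
proof -
  define S where "S = range (\<lambda>(t, \<omega>). (t, hist M x \<omega> t))"
  have "set_pmf (\<pi>s n (fst s) (snd s)) \<subseteq> {1..NC M}" for n s
    using assms(1)[of n] unfolding policies_def by blast
  then obtain r q where r: "strict_mono (r :: nat \<Rightarrow> nat)"
    and q: "\<And>s. s \<in> S \<Longrightarrow> set_pmf (q s) \<subseteq> {1..NC M}"
      "\<And>s u. s \<in> S \<Longrightarrow> (\<lambda>n. pmf (\<pi>s (r n) (fst s) (snd s)) u) \<longlonglongrightarrow> pmf (q s) u"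
    by (rule pmf_seq_compact[OF countable_histories[of M x, folded S_def] finite_atLeastAtMost,
        where p = "\<lambda>n s. \<pi>s n (fst s) (snd s)"]) (rule that)
  \<comment> \<open>Outside \<open>S\<close> the limit is not controlled; action 1 is an admissible
    default because \<open>1 \<le> NC M\<close>.\<close>
  define \<pi> where "\<pi> t h = (if (t, h) \<in> S then q (t, h) else return_pmf 1)" for t h
  show ?thesis
  proof (rule that[OF r])
    have "set_pmf (\<pi> t h) \<subseteq> {1..NC M}" for t h
      using q(1)[of "(t, h)"] assms(2) by (cases "(t, h) \<in> S") (simp_all add: \<pi>_def)
    then show "\<pi> \<in> policies M"
      unfolding policies_def by blast
    have "(\<lambda>n. pmf (\<pi>s (r n) t (hist M x \<omega> t)) u) \<longlonglongrightarrow> pmf (\<pi> t (hist M x \<omega> t)) u" for t \<omega> u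
    proof -
      have "(t, hist M x \<omega> t) \<in> S"
        unfolding S_def by (rule image_eqI[of _ _ "(t, \<omega>)"]) auto
      then show ?thesis
        using q(2)[of "(t, hist M x \<omega> t)" u] by (simp add: \<pi>_def)
    qed
    then show "policy_tendsto M x (\<pi>s \<circ> r) \<pi>"
      by (simp add: policy_tendsto_def)
  qed
qed

section \<open>Minimizing sequences and the maximum over the weights\<close>

text \<open>The direct method: the limit point of a minimizing sequence attains the infimum. The
  assumption \<open>lsc\<close> combines compactness of \<open>K\<close> with lower semicontinuity
  of \<open>\<Phi>\<close>.\<close>

lemma seq_lsc_attains_inf:
  fixes \<Phi> :: "'a \<Rightarrow> ennreal"
  assumes "K \<noteq> {}"
    and lsc: "\<And>s. (\<And>n. s n \<in> K) \<Longrightarrow>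
      \<exists>r a. strict_mono (r :: nat \<Rightarrow> nat) \<and> a \<in> K \<and> \<Phi> a \<le> liminf (\<lambda>n. \<Phi> (s (r n)))"
  shows "\<exists>a\<in>K. \<Phi> a = (INF a\<in>K. \<Phi> a)"
proof -
  obtain f where f: "decseq f" "range f \<subseteq> \<Phi> ` K" "Inf (\<Phi> ` K) = (INF n. f n)"
    using ennreal_Inf_countable_INF[of "\<Phi> ` K"] \<open>K \<noteq> {}\<close> by auto
  have "\<exists>a\<in>K. f n = \<Phi> a" for n
    using f(2) by blast
  then obtain s where s: "\<And>n. s n \<in> K" "\<And>n. f n = \<Phi> (s n)"
    by metis
  obtain r a where r: "strict_mono (r :: nat \<Rightarrow> nat)" and a: "a \<in> K"
      "\<Phi> a \<le> liminf (\<lambda>n. \<Phi> (s (r n)))"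
    using lsc[of s, OF s(1)] by (elim exE conjE) (rule that)
  have "(\<lambda>n. \<Phi> (s (r n))) \<longlonglongrightarrow> Inf (\<Phi> ` K)"
    using LIMSEQ_subseq_LIMSEQ[OF LIMSEQ_INF[OF f(1)] r] unfolding f(3) comp_def s(2) .
  then have "liminf (\<lambda>n. \<Phi> (s (r n))) = Inf (\<Phi> ` K)"
    by (rule lim_imp_Liminf[OF sequentially_bot])
  with a(2) have "\<Phi> a = Inf (\<Phi> ` K)"
    by (intro antisym INF_lower a(1)) simp
  with a(1) show ?thesis ..
qed

lemma J_mix_le_max:
  assumes "\<alpha> \<in> weights"
  shows "J_mix M \<gamma> \<epsilon> c xl \<alpha> \<pi> \<le> max (J_obj M xl \<pi>) (ennreal (c / \<epsilon>) * ennreal (L_d M \<gamma> (fst xl) \<pi>))"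
    (is "_ \<le> ?m")
proof -
  obtain p q where \<alpha>: "\<alpha> = (p, q)" "0 \<le> p" "0 \<le> q" "p + q = 1"
    using assms by (auto simp: weights_def)
  have "J_mix M \<gamma> \<epsilon> c xl \<alpha> \<pi> =
      ennreal p * J_obj M xl \<pi> + ennreal q * (ennreal (c / \<epsilon>) * ennreal (L_d M \<gamma> (fst xl) \<pi>))"
    by (simp add: J_mix_def \<alpha>(1) mult_ac)
  also have "\<dots> \<le> ennreal p * ?m + ennreal q * ?m"
    by (intro add_mono mult_left_mono) auto
  also have "\<dots> = ?m"
    using \<alpha> by (simp flip: distrib_right ennreal_plus)
  finally show ?thesis .
qed

text \<open>The maximum is attained at a vertex of the simplex. At the vertex \<open>(0, 1)\<close>
  an infinite objective disappears, because \<open>0 * \<infinity> = 0\<close> in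
  \<open>ennreal\<close>.\<close>

lemma J_mix_arg_max:
  "\<exists>\<alpha>\<in>weights. J_mix M \<gamma> \<epsilon> c xl \<alpha> \<pi> =
     max (J_obj M xl \<pi>) (ennreal (c / \<epsilon>) * ennreal (L_d M \<gamma> (fst xl) \<pi>))"
proof -
  have "(1, 0) \<in> weights" "(0, 1) \<in> weights"
    by (simp_all add: weights_def)
  moreover have "J_mix M \<gamma> \<epsilon> c xl (1, 0) \<pi> = J_obj M xl \<pi>"
    "J_mix M \<gamma> \<epsilon> c xl (0, 1) \<pi> = ennreal (c / \<epsilon>) * ennreal (L_d M \<gamma> (fst xl) \<pi>)"
    by (simp_all add: J_mix_def)
  ultimately show ?thesis
    by (metis max_def)
qed

lemma J_max_eq:
  "J_max M \<gamma> \<epsilon> c xl \<pi> = max (J_obj M xl \<pi>) (ennreal (c / \<epsilon>) * ennreal (L_d M \<gamma> (fst xl) \<pi>))"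
  unfolding J_max_def
proof (rule antisym)
  show "(SUP \<alpha>\<in>weights. J_mix M \<gamma> \<epsilon> c xl \<alpha> \<pi>) \<le>
      max (J_obj M xl \<pi>) (ennreal (c / \<epsilon>) * ennreal (L_d M \<gamma> (fst xl) \<pi>))"
    by (intro SUP_least J_mix_le_max)
  obtain \<alpha> where \<alpha>: "\<alpha> \<in> weights" "J_mix M \<gamma> \<epsilon> c xl \<alpha> \<pi> =
      max (J_obj M xl \<pi>) (ennreal (c / \<epsilon>) * ennreal (L_d M \<gamma> (fst xl) \<pi>))"
    using J_mix_arg_max by blast
  show "max (J_obj M xl \<pi>) (ennreal (c / \<epsilon>) * ennreal (L_d M \<gamma> (fst xl) \<pi>)) \<le>
      (SUP \<alpha>\<in>weights. J_mix M \<gamma> \<epsilon> c xl \<alpha> \<pi>)"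
    unfolding \<alpha>(2)[symmetric] by (rule SUP_upper[OF \<alpha>(1)])
qed

lemma is_arg_max_J_mix:
  "\<exists>\<alpha>. is_arg_max (\<lambda>\<alpha>. J_mix M \<gamma> \<epsilon> c xl \<alpha> \<pi>) (\<lambda>\<alpha>. \<alpha> \<in> weights) \<alpha>"
proof -
  obtain \<alpha> where "\<alpha> \<in> weights" "J_mix M \<gamma> \<epsilon> c xl \<alpha> \<pi> =
      max (J_obj M xl \<pi>) (ennreal (c / \<epsilon>) * ennreal (L_d M \<gamma> (fst xl) \<pi>))"
    using J_mix_arg_max by blast
  then show ?thesis
    unfolding is_arg_max_def using J_mix_le_max by (metis not_less)
qed

lemma is_arg_min_INF:
  fixes \<Phi> :: "'a \<Rightarrow> ennreal"
  shows "is_arg_min \<Phi> (\<lambda>a. a \<in> K) a \<longleftrightarrow> a \<in> K \<and> \<Phi> a = (INF a\<in>K. \<Phi> a)"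
proof
  assume "is_arg_min \<Phi> (\<lambda>a. a \<in> K) a"
  then have "a \<in> K" "\<And>b. b \<in> K \<Longrightarrow> \<Phi> a \<le> \<Phi> b"
    by (auto simp: is_arg_min_def not_less)
  then show "a \<in> K \<and> \<Phi> a = (INF a\<in>K. \<Phi> a)"
    by (intro conjI antisym INF_greatest INF_lower)
next
  assume a: "a \<in> K \<and> \<Phi> a = (INF a\<in>K. \<Phi> a)"
  have "\<Phi> a \<le> \<Phi> b" if "b \<in> K" for b
    using a INF_lower[OF that, of \<Phi>] by simp
  with a show "is_arg_min \<Phi> (\<lambda>a. a \<in> K) a"
    by (auto simp: is_arg_min_def not_less)
qed

section \<open>Existence of minimizers\<close>

text \<open>By \<open>J_max_eq\<close> the function to be minimized is the maximum of two lower
  semicontinuous functions of the policy.\<close>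

lemma J_max_attained:
  fixes M :: "'w::countable mdp"
  assumes "1 \<le> NC M" "0 < \<gamma>" "\<gamma> < 1"
  shows "\<exists>\<pi>\<in>policies M. J_max M \<gamma> \<epsilon> c (x, Not_failed) \<pi> = minimax M \<gamma> \<epsilon> c (x, Not_failed)"
  unfolding minimax_def
proof (rule seq_lsc_attains_inf)
  have "(\<lambda>_ _. return_pmf 1) \<in> policies M"
    using assms(1) by (simp add: policies_def)
  then show "policies M \<noteq> {}" by blast
next
  fix s :: "nat \<Rightarrow> policy" assume s: "\<And>n. s n \<in> policies M"
  obtain r \<pi> where r: "strict_mono (r :: nat \<Rightarrow> nat)" and \<pi>: "\<pi> \<in> policies M"
    and conv: "policy_tendsto M x (s \<circ> r) \<pi>"
    using policies_seq_compact[of s M x, OF s assms(1)] by blast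
  let ?J = "J_obj M (x, Not_failed)" and ?C = "ennreal (c / \<epsilon>)" and ?L = "\<lambda>\<pi>. ennreal (L_d M \<gamma> x \<pi>)"
  have "?J \<pi> \<le> liminf (\<lambda>n. max (?J (s (r n))) (?C * ?L (s (r n))))"
    using J_obj_lsc[OF conv] by (rule order_trans) (auto intro!: Liminf_mono)
  moreover have "?C * ?L \<pi> \<le> liminf (\<lambda>n. max (?J (s (r n))) (?C * ?L (s (r n))))"
  proof -
    \<comment> \<open>Multiplication by the finite constant \<open>?C\<close> is continuous and
      monotone, so it commutes with \<open>liminf\<close>.\<close>
    have cont: "continuous_on UNIV (\<lambda>y. ?C * y)"
      by (intro ennreal_continuous_on_cmult continuous_on_id) simp
    have "?C * ?L \<pi> \<le> ?C * liminf (\<lambda>n. ?L (s (r n)))"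
      using L_d_lsc[OF conv assms(2,3)] by (intro mult_left_mono) simp_all
    also have "\<dots> = liminf (\<lambda>n. ?C * ?L (s (r n)))"
      by (intro Liminf_compose_continuous_mono[symmetric] cont) (auto simp: mono_def mult_left_mono)
    also have "\<dots> \<le> liminf (\<lambda>n. max (?J (s (r n))) (?C * ?L (s (r n))))"
      by (auto intro!: Liminf_mono)
    finally show ?thesis .
  qed
  ultimately show "\<exists>r a. strict_mono (r :: nat \<Rightarrow> nat) \<and> a \<in> policies M \<and>
      J_max M \<gamma> \<epsilon> c (x, Not_failed) a \<le> liminf (\<lambda>n. J_max M \<gamma> \<epsilon> c (x, Not_failed) (s (r n)))"
    using r \<pi> unfolding J_max_eq fst_conv by (intro exI[of _ r] exI[of _ \<pi>]) simp
qed

text \<open>The feasible set is sequentially closed, since the bound \<open>\<epsilon>\<close>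
  survives in the limit by lower semicontinuity of \<open>L_d\<close>.\<close>

lemma J_obj_attained:
  fixes M :: "'w::countable mdp"
  assumes "1 \<le> NC M" "0 < \<gamma>" "\<gamma> < 1" "0 < \<epsilon>" "Pi_hat M \<gamma> \<epsilon> x \<noteq> {}"
  shows "\<exists>\<pi>\<in>Pi_hat M \<gamma> \<epsilon> x. J_obj M (x, Not_failed) \<pi> = (INF \<pi>\<in>Pi_hat M \<gamma> \<epsilon> x. J_obj M (x, Not_failed) \<pi>)"
proof (rule seq_lsc_attains_inf[OF assms(5)])
  fix s :: "nat \<Rightarrow> policy" assume s: "\<And>n. s n \<in> Pi_hat M \<gamma> \<epsilon> x"
  then have "\<And>n. s n \<in> policies M" and L: "\<And>n. L_d M \<gamma> x (s n) \<le> \<epsilon>"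
    by (simp_all add: Pi_hat_def)
  then obtain r \<pi> where r: "strict_mono (r :: nat \<Rightarrow> nat)" and \<pi>: "\<pi> \<in> policies M"
    and conv: "policy_tendsto M x (s \<circ> r) \<pi>"
    using policies_seq_compact[of s M x, OF _ assms(1)] by blast
  have "ennreal (L_d M \<gamma> x \<pi>) \<le> liminf (\<lambda>n. ennreal (L_d M \<gamma> x (s (r n))))"
    using L_d_lsc[OF conv assms(2,3)] by simp
  also have "\<dots> \<le> liminf (\<lambda>n::nat. ennreal \<epsilon>)"
    using L by (intro Liminf_mono always_eventually allI ennreal_leI)
  finally have "\<pi> \<in> Pi_hat M \<gamma> \<epsilon> x"
    using \<pi> assms(4) by (simp add: Pi_hat_def Liminf_const)
  then show "\<exists>r a. strict_mono (r :: nat \<Rightarrow> nat) \<and> a \<in> Pi_hat M \<gamma> \<epsilon> x \<and>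
      J_obj M (x, Not_failed) a \<le> liminf (\<lambda>n. J_obj M (x, Not_failed) (s (r n)))"
    using r J_obj_lsc[OF conv] by (intro exI[of _ r] exI[of _ \<pi>]) simp
qed

section \<open>Admissible thresholds and the constrained value\<close>

text \<open>The scaling \<open>c / \<epsilon>\<close> makes the bound \<open>c\<close> on the second
  term equivalent to feasibility: cancelling \<open>c > 0\<close> leaves
  \<open>L_d M \<gamma> x \<pi> \<le> \<epsilon>\<close>.\<close>

lemma J_max_le_iff:
  assumes "0 < c" "0 < \<epsilon>"
  shows "J_max M \<gamma> \<epsilon> c (x, Not_failed) \<pi> \<le> ennreal c \<longleftrightarrow>
    J_obj M (x, Not_failed) \<pi> \<le> ennreal c \<and> L_d M \<gamma> x \<pi> \<le> \<epsilon>"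
proof -
  have "ennreal (c / \<epsilon>) * ennreal (L_d M \<gamma> x \<pi>) \<le> ennreal c \<longleftrightarrow>
      ennreal (c / \<epsilon> * L_d M \<gamma> x \<pi>) \<le> ennreal c"
    using assms by (subst ennreal_mult') auto
  also have "\<dots> \<longleftrightarrow> c / \<epsilon> * L_d M \<gamma> x \<pi> \<le> c"
    using assms by (subst ennreal_le_iff) auto
  also have "\<dots> \<longleftrightarrow> L_d M \<gamma> x \<pi> \<le> \<epsilon>"
    using assms by (simp add: field_simps)
  finally show ?thesis by (simp add: J_max_eq)
qed

text \<open>Both infima are attained, so each inequality is witnessed by a single policy, and
  \<open>J_max_le_iff\<close> compares the witnesses.\<close>

lemma minimax_le_iff:
  fixes M :: "'w::countable mdp"
  assumes "1 \<le> NC M" "0 < \<gamma>" "\<gamma> < 1" "0 < \<epsilon>" "0 < c"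
  shows "minimax M \<gamma> \<epsilon> c (x, Not_failed) \<le> ennreal c \<longleftrightarrow>
    (INF \<pi>\<in>Pi_hat M \<gamma> \<epsilon> x. J_obj M (x, Not_failed) \<pi>) \<le> ennreal c"
proof
  assume le: "minimax M \<gamma> \<epsilon> c (x, Not_failed) \<le> ennreal c"
  obtain \<pi> where "\<pi> \<in> policies M" "J_max M \<gamma> \<epsilon> c (x, Not_failed) \<pi> = minimax M \<gamma> \<epsilon> c (x, Not_failed)"
    using J_max_attained[OF assms(1-3)] by blast
  with le have "\<pi> \<in> Pi_hat M \<gamma> \<epsilon> x" "J_obj M (x, Not_failed) \<pi> \<le> ennreal c"
    using J_max_le_iff[OF assms(5,4), of M \<gamma> x \<pi>] by (simp_all add: Pi_hat_def)
  then show "(INF \<pi>\<in>Pi_hat M \<gamma> \<epsilon> x. J_obj M (x, Not_failed) \<pi>) \<le> ennreal c"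
    by (blast intro: INF_lower2)
next
  assume le: "(INF \<pi>\<in>Pi_hat M \<gamma> \<epsilon> x. J_obj M (x, Not_failed) \<pi>) \<le> ennreal c"
  \<comment> \<open>Over an empty feasible set the infimum would be \<open>\<top>\<close>, which
    exceeds every \<open>ennreal c\<close>.\<close>
  then have "Pi_hat M \<gamma> \<epsilon> x \<noteq> {}" by (auto simp: top_unique)
  then obtain \<pi> where "\<pi> \<in> Pi_hat M \<gamma> \<epsilon> x" "J_obj M (x, Not_failed) \<pi> \<le> ennreal c"
    using J_obj_attained[OF assms(1-4)] le by metis
  then have "\<pi> \<in> policies M" "J_max M \<gamma> \<epsilon> c (x, Not_failed) \<pi> \<le> ennreal c"
    using J_max_le_iff[OF assms(5,4), of M \<gamma> x \<pi>] by (simp_all add: Pi_hat_def)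
  then show "minimax M \<gamma> \<epsilon> c (x, Not_failed) \<le> ennreal c"
    unfolding minimax_def by (blast intro: INF_lower2)
qed

lemma minimax_0: "minimax M \<gamma> \<epsilon> 0 (x, Not_failed) = (INF \<pi>\<in>policies M. J_MCMP M x \<pi>)"
  by (simp add: minimax_def J_max_eq J_obj_eq_J_MCMP)

text \<open>By density this also covers \<open>v = 0\<close>, where the infimum is not attained, and
  \<open>v = \<infinity>\<close>, where the set is empty.\<close>

lemma Inf_ennreal_above:
  "Inf (ennreal ` {c \<in> {0<..}. v \<le> ennreal c}) = v"
proof (rule antisym)
  show "v \<le> Inf (ennreal ` {c \<in> {0<..}. v \<le> ennreal c})"
    by (rule Inf_greatest) auto
  show "Inf (ennreal ` {c \<in> {0<..}. v \<le> ennreal c}) \<le> v"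
  proof (rule dense_ge)
    fix y assume "v < y"
    show "Inf (ennreal ` {c \<in> {0<..}. v \<le> ennreal c}) \<le> y"
    proof (cases y)
      case (real c)
      with \<open>v < y\<close> have "0 < c" by (auto simp: less_le)
      with real \<open>v < y\<close> show ?thesis by (intro Inf_lower) auto
    qed simp
  qed
qed

lemma c_star_pos_eq:
  fixes M :: "'w::countable mdp"
  assumes "1 \<le> NC M" "0 < \<gamma>" "\<gamma> < 1" "0 < \<epsilon>"
  shows "c_star_pos M \<gamma> \<epsilon> x = (INF \<pi>\<in>Pi_hat M \<gamma> \<epsilon> x. J_obj M (x, Not_failed) \<pi>)"
proof -
  have "{c \<in> {0<..}. minimax M \<gamma> \<epsilon> c (x, Not_failed) \<le> ennreal c} =
      {c \<in> {0<..}. (INF \<pi>\<in>Pi_hat M \<gamma> \<epsilon> x. J_obj M (x, Not_failed) \<pi>) \<le> ennreal c}"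
    using minimax_le_iff[OF assms] by auto
  then show ?thesis
    unfolding c_star_pos_def by (simp only: Inf_ennreal_above)
qed

text \<open>The two thresholds differ only in whether \<open>c = 0\<close> may compete, and by
  \<open>minimax_0\<close> it is admissible exactly when the unconstrained infimum is 0.\<close>

lemma c_star_eq:
  fixes M :: "'w::countable mdp"
  assumes "1 \<le> NC M" "0 < \<gamma>" "\<gamma> < 1" "0 < \<epsilon>"
  shows "c_star M \<gamma> \<epsilon> x =
    (if (INF \<pi>\<in>policies M. J_MCMP M x \<pi>) = 0 then 0
     else (INF \<pi>\<in>Pi_hat M \<gamma> \<epsilon> x. J_obj M (x, Not_failed) \<pi>))"
proof -
  let ?C = "{c \<in> {0..}. minimax M \<gamma> \<epsilon> c (x, Not_failed) \<le> ennreal c}"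
  let ?P = "{c \<in> {0<..}. minimax M \<gamma> \<epsilon> c (x, Not_failed) \<le> ennreal c}"
  have zero: "0 \<in> ?C \<longleftrightarrow> (INF \<pi>\<in>policies M. J_MCMP M x \<pi>) = 0"
    by (simp add: minimax_0)
  show ?thesis
  proof (cases "(INF \<pi>\<in>policies M. J_MCMP M x \<pi>) = 0")
    case True
    then have "0 \<in> ennreal ` ?C"
      using zero by (intro image_eqI[of _ _ 0]) auto
    then have "c_star M \<gamma> \<epsilon> x \<le> 0"
      unfolding c_star_def by (rule Inf_lower)
    with True show ?thesis by simp
  next
    case False
    then have "0 \<notin> ?C" using zero by blast
    then have "?C = ?P" by (auto simp: less_le)
    then have "c_star M \<gamma> \<epsilon> x = c_star_pos M \<gamma> \<epsilon> x"
      unfolding c_star_def c_star_pos_def by (rule arg_cong)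
    with False show ?thesis by (simp add: c_star_pos_eq[OF assms])
  qed
qed

text \<open>For \<open>v > 0\<close> this is \<open>minimax_le_iff\<close> at \<open>c = v\<close>.
  For \<open>v = 0\<close> the minimax value is the unconstrained infimum, which is at most the
  constrained one.\<close>

lemma minimax_at_value:
  fixes M :: "'w::countable mdp"
  assumes "1 \<le> NC M" "0 < \<gamma>" "\<gamma> < 1" "0 < \<epsilon>"
    and v: "v = (INF \<pi>\<in>Pi_hat M \<gamma> \<epsilon> x. J_obj M (x, Not_failed) \<pi>)" "v < \<infinity>"
  shows "minimax M \<gamma> \<epsilon> (enn2real v) (x, Not_failed) \<le> v"
proof (cases "v = 0")
  case True
  have "(INF \<pi>\<in>policies M. J_MCMP M x \<pi>) \<le> v"
    unfolding v(1) J_obj_eq_J_MCMP by (rule INF_superset_mono) (auto simp: Pi_hat_def)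
  with True show ?thesis by (simp add: minimax_0)
next
  case False
  have eq: "ennreal (enn2real v) = v" using v(2) by simp
  have "0 < enn2real v" using False v(2) by (simp add: enn2real_positive_iff zero_less_iff_neq_zero)
  then have "minimax M \<gamma> \<epsilon> (enn2real v) (x, Not_failed) \<le> ennreal (enn2real v)"
    by (subst minimax_le_iff[OF assms(1-4)]) (simp_all add: eq flip: v(1))
  then show ?thesis by (simp only: eq)
qed

lemma J_obj_opt_policy:
  fixes M :: "'w::countable mdp"
  assumes "1 \<le> NC M" "0 < \<gamma>" "\<gamma> < 1" "0 < \<epsilon>"
    and v: "v = (INF \<pi>\<in>Pi_hat M \<gamma> \<epsilon> x. J_obj M (x, Not_failed) \<pi>)" "v < \<infinity>"
    and \<pi>: "\<pi> \<in> opt_policies M \<gamma> \<epsilon> (enn2real v) (x, Not_failed)"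
  shows "J_obj M (x, Not_failed) \<pi> = v"
proof -
  have eq: "ennreal (enn2real v) = v" using v(2) by simp
  have "\<pi> \<in> policies M" "J_max M \<gamma> \<epsilon> (enn2real v) (x, Not_failed) \<pi> =
      minimax M \<gamma> \<epsilon> (enn2real v) (x, Not_failed)"
    using \<pi> by (simp_all add: opt_policies_def is_arg_min_INF minimax_def)
  with minimax_at_value[OF assms(1-4) v] have le: "J_max M \<gamma> \<epsilon> (enn2real v) (x, Not_failed) \<pi> \<le> v"
    by simp
  then have "J_obj M (x, Not_failed) \<pi> \<le> v"
    by (simp add: J_max_eq)
  moreover have "v \<le> J_obj M (x, Not_failed) \<pi>"
  proof (cases "v = 0")
    case False
    then have "0 < enn2real v" using v(2) by (simp add: enn2real_positive_iff zero_less_iff_neq_zero)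
    then have "L_d M \<gamma> x \<pi> \<le> \<epsilon>"
      using le J_max_le_iff[of "enn2real v" \<epsilon> M \<gamma> x \<pi>] assms(4) eq by simp
    with \<open>\<pi> \<in> policies M\<close> have "\<pi> \<in> Pi_hat M \<gamma> \<epsilon> x"
      by (simp add: Pi_hat_def)
    then show ?thesis unfolding v(1) by (rule INF_lower)
  qed simp
  ultimately show ?thesis by (rule antisym)
qed

text \<open>Each minimum appears as an infimum together with its attainment. The equality with
  \<open>c_star\<close> carries a premise because, by \<open>c_star_eq\<close>, it fails when the
  unconstrained infimum is 0 and the constrained one is positive; for \<open>c_star_pos\<close> it
  holds without this premise. The guards \<open>< \<infinity>\<close> are there because
  \<open>enn2real\<close> sends \<open>\<infinity>\<close> to 0.\<close>

theorem theorem6: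
  fixes M :: "'w::countable mdp" and \<gamma> \<epsilon> :: real and x :: nat
  assumes "wf_mdp M" and "0 < \<gamma>" and "\<gamma> < 1" and "0 < \<epsilon>" and "x \<in> {0..NX M}"
  shows
    "(Pi_hat M \<gamma> \<epsilon> x \<noteq> {} \<longrightarrow>
        (\<exists>\<pi>. is_arg_min (J_MCMP M x) (\<lambda>\<pi>. \<pi> \<in> Pi_hat M \<gamma> \<epsilon> x) \<pi>) \<and>
        (\<exists>\<pi>. is_arg_min (J_obj M (x, Not_failed)) (\<lambda>\<pi>. \<pi> \<in> Pi_hat M \<gamma> \<epsilon> x) \<pi>)) \<and>
     (\<forall>c\<ge>0. opt_policies M \<gamma> \<epsilon> c (x, Not_failed) \<noteq> {} \<and>
        (\<forall>\<pi>\<in>policies M. \<exists>\<alpha>. is_arg_max (\<lambda>\<alpha>. J_mix M \<gamma> \<epsilon> c (x, Not_failed) \<alpha> \<pi>) (\<lambda>\<alpha>. \<alpha> \<in> weights) \<alpha>)) \<and>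
     (c_star M \<gamma> \<epsilon> x < \<infinity> \<longrightarrow>
        minimax M \<gamma> \<epsilon> (enn2real (c_star M \<gamma> \<epsilon> x)) (x, Not_failed) \<le> c_star M \<gamma> \<epsilon> x) \<and>
     (INF \<pi>\<in>Pi_hat M \<gamma> \<epsilon> x. J_MCMP M x \<pi>) = (INF \<pi>\<in>Pi_hat M \<gamma> \<epsilon> x. J_obj M (x, Not_failed) \<pi>) \<and>
     (((INF \<pi>\<in>policies M. J_MCMP M x \<pi>) = 0 \<longrightarrow> (INF \<pi>\<in>Pi_hat M \<gamma> \<epsilon> x. J_MCMP M x \<pi>) = 0) \<longrightarrow>
        (INF \<pi>\<in>Pi_hat M \<gamma> \<epsilon> x. J_obj M (x, Not_failed) \<pi>) = c_star M \<gamma> \<epsilon> x \<and>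
        (c_star M \<gamma> \<epsilon> x < \<infinity> \<longrightarrow>
          (\<forall>\<pi>\<in>opt_policies M \<gamma> \<epsilon> (enn2real (c_star M \<gamma> \<epsilon> x)) (x, Not_failed).
             J_obj M (x, Not_failed) \<pi> = c_star M \<gamma> \<epsilon> x))) \<and>
     (INF \<pi>\<in>Pi_hat M \<gamma> \<epsilon> x. J_obj M (x, Not_failed) \<pi>) = c_star_pos M \<gamma> \<epsilon> x \<and>
     (c_star_pos M \<gamma> \<epsilon> x < \<infinity> \<longrightarrow>
       (\<forall>\<pi>\<in>opt_policies M \<gamma> \<epsilon> (enn2real (c_star_pos M \<gamma> \<epsilon> x)) (x, Not_failed).
          J_obj M (x, Not_failed) \<pi> = c_star_pos M \<gamma> \<epsilon> x))"
proof -
  have NC: "1 \<le> NC M" using assms(1) by (simp add: wf_mdp_def)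
  note params = NC assms(2-4)
  let ?V = "INF \<pi>\<in>Pi_hat M \<gamma> \<epsilon> x. J_obj M (x, Not_failed) \<pi>"
  let ?U = "INF \<pi>\<in>policies M. J_MCMP M x \<pi>"
  have MCMP: "J_MCMP M x = J_obj M (x, Not_failed)"
    by (rule ext) (simp add: J_obj_eq_J_MCMP)
  have min: "\<exists>\<pi>. is_arg_min (J_obj M (x, Not_failed)) (\<lambda>\<pi>. \<pi> \<in> Pi_hat M \<gamma> \<epsilon> x) \<pi>"
    if "Pi_hat M \<gamma> \<epsilon> x \<noteq> {}"
    unfolding is_arg_min_INF using J_obj_attained[OF params that] by blast
  have opt: "opt_policies M \<gamma> \<epsilon> c (x, Not_failed) \<noteq> {}" for c
    using J_max_attained[OF params(1-3), of \<epsilon> c x]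
    unfolding opt_policies_def is_arg_min_INF minimax_def by blast
  have c_pos: "?V = c_star_pos M \<gamma> \<epsilon> x"
    by (rule c_star_pos_eq[OF params, symmetric])
  have c: "?V = c_star M \<gamma> \<epsilon> x" if "?U = 0 \<longrightarrow> ?V = 0"
    unfolding c_star_eq[OF params] using that by simp
  have c_le: "minimax M \<gamma> \<epsilon> (enn2real (c_star M \<gamma> \<epsilon> x)) (x, Not_failed) \<le> c_star M \<gamma> \<epsilon> x"
    if "c_star M \<gamma> \<epsilon> x < \<infinity>"
  proof (cases "?U = 0")
    case True
    then show ?thesis
      unfolding c_star_eq[OF params] by (simp add: minimax_0)
  next
    \<comment> \<open>The premise of \<open>c\<close> now holds vacuously, so \<open>c_star\<close>
      is the constrained value.\<close>
    case False
    then show ?thesis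
      using minimax_at_value[OF params c[symmetric] that] by blast
  qed
  show ?thesis
    unfolding MCMP
  proof (intro conjI impI allI ballI min opt is_arg_max_J_mix c_le refl c c_pos)
    fix \<pi>
    assume "(INF \<pi>\<in>policies M. J_obj M (x, Not_failed) \<pi>) = 0 \<longrightarrow> ?V = 0"
      and "c_star M \<gamma> \<epsilon> x < \<infinity>"
      and "\<pi> \<in> opt_policies M \<gamma> \<epsilon> (enn2real (c_star M \<gamma> \<epsilon> x)) (x, Not_failed)"
    then show "J_obj M (x, Not_failed) \<pi> = c_star M \<gamma> \<epsilon> x"
      using J_obj_opt_policy[OF params c[symmetric]] by (simp add: MCMP)
  next
    fix \<pi>
    assume "c_star_pos M \<gamma> \<epsilon> x < \<infinity>"
      and "\<pi> \<in> opt_policies M \<gamma> \<epsilon> (enn2real (c_star_pos M \<gamma> \<epsilon> x)) (x, Not_failed)"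
    then show "J_obj M (x, Not_failed) \<pi> = c_star_pos M \<gamma> \<epsilon> x"
      by (rule J_obj_opt_policy[OF params c_pos[symmetric]])
  qed (simp_all add: MCMP)
qed

end
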